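(* There is a deterministic algorithm in the vertex oracle model that finds the global sink of an $i$-nice $n$-dimensional unique sink orientation $\psi$ using $O(n^{i+1})$ vertex evaluations.
   Context: Let $Q^n = 2^{[n]}$ be the vertex set of the $n$-cube, with $u,v$ adjacent iff $|u\oplus v|=1$; faces are $F_{J,v}=\{u : v\oplus u\subseteq J\}$ for $J\subseteq[n]$. A unique sink orientation (USO) is an orientation of the cube's edges such that every nonempty face has a unique sink (vertex with no outgoing edges within the face). The outmap $s_\psi(v)$ is the set of coordinates $j$ such that the edge $\{v,v\oplus\{j\}\}$ is directed away from $v$; the global sink is the vertex $t$ with $s_\psi(t)=\emptyset$. Let $d(v,u)$ be the length of a shortest directed path from $v$ to $u$ ($\infty$ if none). The reachmap is $r_\psi(v)=s_\psi(v)\cup\{j : \exists u \text{ reachable from } v \text{ by a directed path with } j\in s_\psi(u)\}$. A vertex $v$ is $i$-covered by $u$ if $d(v,u)\le i$ and $r_\psi(u)\subsetneq r_\psi(v)$; $\psi$ is $i$-nice if every vertex other than the global sink is $i$-covered by some vertex. In the vertex oracle model, a vertex evaluation is a query which, given $v$, returns $s_\psi(v)$. *)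

theory Defs
  imports Main
begin

text \<open>Coordinates [n] are rendered as {0..<n}; vertices of Q^n are subsets of {0..<n}.\<close>

definition sdiff :: "nat set \<Rightarrow> nat set \<Rightarrow> nat set" where
  "sdiff A B = (A - B) \<union> (B - A)"

definition cube :: "nat \<Rightarrow> nat set set" where
  "cube n = Pow {0..<n}"

definition face :: "nat \<Rightarrow> nat set \<Rightarrow> nat set \<Rightarrow> nat set set" where
  "face n J v = {u \<in> cube n. sdiff v u \<subseteq> J}"

text \<open>An orientation of the edges of Q^n, given by its outmap s: coordinate j is in s v iff
  the edge {v, v xor {j}} is directed away from v. Consistency: each edge gets exactly one
  direction.\<close>
definition orientation :: "nat \<Rightarrow> (nat set \<Rightarrow> nat set) \<Rightarrow> bool" where
  "orientation n s \<longleftrightarrow> (\<forall>v\<in>cube n. s v \<subseteq> {0..<n} \<and>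
      (\<forall>j<n. j \<in> s v \<longleftrightarrow> j \<notin> s (sdiff v {j})))"

definition arc :: "nat \<Rightarrow> (nat set \<Rightarrow> nat set) \<Rightarrow> nat set \<Rightarrow> nat set \<Rightarrow> bool" where
  "arc n s u w \<longleftrightarrow> u \<in> cube n \<and> (\<exists>j<n. w = sdiff u {j} \<and> j \<in> s u)"

definition is_sink_of :: "nat \<Rightarrow> (nat set \<Rightarrow> nat set) \<Rightarrow> nat set set \<Rightarrow> nat set \<Rightarrow> bool" where
  "is_sink_of n s F u \<longleftrightarrow> u \<in> F \<and> (\<forall>w\<in>F. \<not> arc n s u w)"

definition USO :: "nat \<Rightarrow> (nat set \<Rightarrow> nat set) \<Rightarrow> bool" where
  "USO n s \<longleftrightarrow> orientation n s \<and>
     (\<forall>J v. J \<subseteq> {0..<n} \<and> v \<in> cube n \<longrightarrow> (\<exists>!u. is_sink_of n s (face n J v) u))"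

definition global_sink :: "nat \<Rightarrow> (nat set \<Rightarrow> nat set) \<Rightarrow> nat set \<Rightarrow> bool" where
  "global_sink n s t \<longleftrightarrow> t \<in> cube n \<and> s t = {}"

definition dist_le :: "nat \<Rightarrow> (nat set \<Rightarrow> nat set) \<Rightarrow> nat set \<Rightarrow> nat set \<Rightarrow> nat \<Rightarrow> bool" where
  "dist_le n s v u i \<longleftrightarrow> (\<exists>k\<le>i. (arc n s ^^ k) v u)"

definition reachmap :: "nat \<Rightarrow> (nat set \<Rightarrow> nat set) \<Rightarrow> nat set \<Rightarrow> nat set" where
  "reachmap n s v = s v \<union> {j. \<exists>u. (arc n s)\<^sup>*\<^sup>* v u \<and> j \<in> s u}"

definition covered :: "nat \<Rightarrow> (nat set \<Rightarrow> nat set) \<Rightarrow> nat \<Rightarrow> nat set \<Rightarrow> nat set \<Rightarrow> bool" where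
  "covered n s i v u \<longleftrightarrow> dist_le n s v u i \<and> reachmap n s u \<subset> reachmap n s v"

definition nice :: "nat \<Rightarrow> nat \<Rightarrow> (nat set \<Rightarrow> nat set) \<Rightarrow> bool" where
  "nice n i s \<longleftrightarrow> (\<forall>v\<in>cube n. \<not> global_sink n s v \<longrightarrow> (\<exists>u. covered n s i v u))"

text \<open>Deterministic algorithms in the vertex oracle model, as (adaptive) decision trees:
  either output a vertex, or query a vertex v and continue depending on the answer s(v).\<close>
datatype alg = Output "nat set" | Query "nat set" "nat set \<Rightarrow> alg"

primrec run :: "(nat set \<Rightarrow> nat set) \<Rightarrow> alg \<Rightarrow> nat set \<times> nat" where
  "run s (Output v) = (v, 0)"
| "run s (Query v k) = (fst (run s (k (s v))), Suc (snd (run s (k (s v)))))"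

end

theory Submission
  imports Defs
begin

text \<open>
  Call \<open>d\<close> the Hamming distance. If the current vertex \<open>p\<close> has no outgoing coordinate in
  \<open>p \<oplus> u\<close>, then \<open>p\<close> is the sink of the face spanned by \<open>p\<close> and \<open>u\<close>, and hence \<open>u\<close> reaches \<open>p\<close>.
  So walking from \<open>p\<close> greedily towards \<open>u\<close> until this happens ends in a vertex \<open>q\<close> reachable from
  both \<open>p\<close> and \<open>u\<close>, after \<open>d p u - d q u\<close> steps. One round starts in \<open>p = v\<close> and does this in turn
  for all targets \<open>u\<close> with \<open>d v u \<le> i\<close>; the final vertex is reachable from a vertex covering \<open>v\<close>,
  so its reachmap is smaller than that of \<open>v\<close>, and \<open>n\<close> rounds suffice. By the triangle inequality
  \<open>d p u - d q u \<le> d v p - d v q + 2 * d v u\<close>, so the steps of a round telescope to at most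
  \<open>2 * i\<close> per target, and there are \<open>O(n\<^sup>i)\<close> targets.
\<close>

section \<open>Symmetric differences and Hamming distance\<close>

lemma sdiff_self [simp]: "sdiff v v = {}"
  by (simp add: sdiff_def)

lemma sdiff_commute: "sdiff u v = sdiff v u"
  by (auto simp: sdiff_def)

lemma sdiff_sdiff_right: "sdiff p (sdiff u {j}) = sdiff (sdiff p u) {j}"
  by (auto simp: sdiff_def)

lemma sdiff_singleton_mem: "j \<in> A \<Longrightarrow> sdiff A {j} = A - {j}"
  by (auto simp: sdiff_def)

lemma sdiff_in_cube: "p \<in> cube n \<Longrightarrow> u \<in> cube n \<Longrightarrow> sdiff p u \<in> cube n"
  by (auto simp: sdiff_def cube_def)

lemma sdiff_singleton_in_cube: "p \<in> cube n \<Longrightarrow> j < n \<Longrightarrow> sdiff p {j} \<in> cube n"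
  by (auto simp: sdiff_def cube_def)

lemma finite_cube_member: "p \<in> cube n \<Longrightarrow> finite p"
  by (auto simp: cube_def intro: finite_subset)

lemma card_sdiff_le_dim:
  assumes "p \<in> cube n" "u \<in> cube n"
  shows "card (sdiff p u) \<le> n"
  using card_mono[of "{0..<n}" "sdiff p u"] sdiff_in_cube[OF assms] by (auto simp: cube_def)

lemma card_sdiff_triangle:
  assumes "finite a" "finite b" "finite c"
  shows "card (sdiff a c) \<le> card (sdiff a b) + card (sdiff b c)"
proof -
  have "card (sdiff a c) \<le> card (sdiff a b \<union> sdiff b c)"
    using assms by (intro card_mono) (auto simp: sdiff_def)
  also have "\<dots> \<le> card (sdiff a b) + card (sdiff b c)" by (rule card_Un_le)
  finally show ?thesis .
qed

section \<open>Greedy walks towards one target\<close>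

text \<open>By uniqueness of the sink, every vertex of the face other than \<open>p\<close> has an
  arc leaving it within the face; following such arcs approaches \<open>p\<close>.\<close>

lemma reaches_sink_of_spanned_face:
  assumes "USO n s" "p \<in> cube n" "u \<in> cube n" "s p \<inter> sdiff p u = {}"
  shows "(arc n s)\<^sup>*\<^sup>* u p"
  using assms(3,4)
proof (induction "card (sdiff p u)" arbitrary: u rule: less_induct)
  case less
  show ?case
  proof (cases "u = p")
    case False
    let ?F = "face n (sdiff p u) p"
    have "sdiff p u \<subseteq> {0..<n}"
      using sdiff_in_cube[OF assms(2) less.prems(1)] by (simp add: cube_def)
    then have unique: "\<exists>!x. is_sink_of n s ?F x"
      using assms(1,2) by (simp add: USO_def)
    have "is_sink_of n s ?F p"
      using less.prems(2) assms(2)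
      by (auto simp: is_sink_of_def face_def arc_def sdiff_def split: if_splits)
    then have "\<not> is_sink_of n s ?F u"
      using unique False by blast
    then obtain w where w: "w \<in> ?F" "arc n s u w"
      using less.prems(1) by (auto simp: is_sink_of_def face_def)
    then obtain j where j: "w = sdiff u {j}" by (auto simp: arc_def)
    \<comment> \<open>Flipping a coordinate on which \<open>p\<close> and \<open>u\<close> agree
      would leave the face.\<close>
    have "j \<in> sdiff p u"
      using w(1) unfolding j face_def sdiff_def by auto
    then have diff: "sdiff p w = sdiff p u - {j}"
      by (simp add: j sdiff_sdiff_right sdiff_singleton_mem)
    have "finite (sdiff p u)"
      using sdiff_in_cube[OF assms(2) less.prems(1)] by (rule finite_cube_member)
    then have "card (sdiff p w) < card (sdiff p u)"
      using \<open>j \<in> sdiff p u\<close> unfolding diff by (rule card_Diff1_less)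
    moreover have "w \<in> cube n" using w(1) by (simp add: face_def)
    moreover have "s p \<inter> sdiff p w = {}" using less.prems(2) diff by blast
    ultimately have "(arc n s)\<^sup>*\<^sup>* w p" by (rule less.hyps)
    with w(2) show ?thesis by (rule converse_rtranclp_into_rtranclp)
  qed simp
qed

text \<open>The first argument is fuel; \<open>card (sdiff p u)\<close> is enough.\<close>

primrec chase :: "nat \<Rightarrow> nat set \<Rightarrow> nat set \<Rightarrow> (nat set \<Rightarrow> alg) \<Rightarrow> alg" where
  "chase 0 p u k = k p"
| "chase (Suc f) p u k = Query p (\<lambda>S.
     let D = S \<inter> sdiff p u in if D = {} then k p else chase f (sdiff p {Min D}) u k)"

text \<open>Algorithms are composed by continuations; this charges a fragment's queries separately
  from those of whatever follows.\<close>

definition add_queries :: "nat \<Rightarrow> nat set \<times> nat \<Rightarrow> nat set \<times> nat" where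
  "add_queries c r = (fst r, c + snd r)"

lemma add_queries_0 [simp]: "add_queries 0 r = r"
  by (simp add: add_queries_def)

lemma add_queries_add: "add_queries a (add_queries b r) = add_queries (a + b) r"
  by (simp add: add_queries_def)

lemma run_Query: "run s (Query v k) = add_queries 1 (run s (k (s v)))"
  by (simp add: add_queries_def)

text \<open>Every query but the last brings the walk one closer to \<open>u\<close>; the summand 1
  pays for the query that finds no usable coordinate. \<open>q\<close> and \<open>c\<close> are
  chosen before \<open>k\<close>, so the fragment's effect is independent of its
  continuation.\<close>

lemma run_chase:
  assumes "USO n s" "u \<in> cube n" "p \<in> cube n" "card (sdiff p u) \<le> f"
  shows "\<exists>q c. q \<in> cube n \<and> (arc n s)\<^sup>*\<^sup>* p q \<and> (arc n s)\<^sup>*\<^sup>* u q \<and>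
           (\<forall>k. run s (chase f p u k) = add_queries c (run s (k q))) \<and>
           c + card (sdiff q u) \<le> card (sdiff p u) + 1"
  using assms(3,4)
proof (induction f arbitrary: p)
  case 0
  then have "sdiff p u = {}"
    using finite_cube_member[OF sdiff_in_cube[OF 0(1) assms(2)]] by simp
  then have "p = u" by (auto simp: sdiff_def)
  then show ?case
    using 0(1) by (intro exI[of _ p] exI[of _ 0]) simp
next
  case (Suc f)
  define D where "D = s p \<inter> sdiff p u"
  have cube: "sdiff p u \<in> cube n" using Suc.prems(1) assms(2) by (rule sdiff_in_cube)
  then have fin: "finite (sdiff p u)" by (rule finite_cube_member)
  show ?case
  proof (cases "D = {}")
    case True
    then have "(arc n s)\<^sup>*\<^sup>* u p"
      using assms(1,2) Suc.prems(1) by (intro reaches_sink_of_spanned_face) (auto simp: D_def)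
    moreover have "run s (chase (Suc f) p u k) = add_queries 1 (run s (k p))" for k
      using True by (simp add: D_def add_queries_def)
    ultimately show ?thesis
      using Suc.prems(1) by (intro exI[of _ p] exI[of _ 1]) simp
  next
    case False
    \<comment> \<open>The minimum merely makes the choice of a coordinate deterministic.\<close>
    define p' where "p' = sdiff p {Min D}"
    have "Min D \<in> D" using False fin by (intro Min_in) (auto simp: D_def)
    then have Min: "Min D \<in> s p" "Min D \<in> sdiff p u" by (auto simp: D_def)
    then have "Min D < n" using cube by (auto simp: cube_def)
    then have p': "p' \<in> cube n" "arc n s p p'"
      using Suc.prems(1) Min(1) by (auto simp: p'_def arc_def sdiff_singleton_in_cube)
    have "sdiff p' u = sdiff p u - {Min D}"
      using Min(2) unfolding p'_def by (metis sdiff_commute sdiff_sdiff_right sdiff_singleton_mem)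
    then have card: "Suc (card (sdiff p' u)) = card (sdiff p u)"
      using Min(2) fin card.remove by metis
    then have "card (sdiff p' u) \<le> f" using Suc.prems(2) by simp
    from Suc.IH[OF p'(1) this] obtain q c where q: "q \<in> cube n" "(arc n s)\<^sup>*\<^sup>* p' q"
      "(arc n s)\<^sup>*\<^sup>* u q" "\<And>k. run s (chase f p' u k) = add_queries c (run s (k q))"
      "c + card (sdiff q u) \<le> card (sdiff p' u) + 1" by blast
    have "run s (chase (Suc f) p u k) = add_queries (Suc c) (run s (k q))" for k
      using False q(4)[of k]
      by (simp add: run_Query add_queries_add flip: D_def p'_def del: run.simps(2))
    moreover have "(arc n s)\<^sup>*\<^sup>* p q"
      using p'(2) q(2) by (rule converse_rtranclp_into_rtranclp)
    ultimately show ?thesis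
      using q(1,3,5) card by (intro exI[of _ q] exI[of _ "Suc c"]) simp
  qed
qed

section \<open>Walking towards a list of targets\<close>

text \<open>Fuel \<open>n\<close> suffices, since it is the diameter of the cube.\<close>

primrec sweep :: "nat \<Rightarrow> nat set list \<Rightarrow> nat set \<Rightarrow> (nat set \<Rightarrow> alg) \<Rightarrow> alg" where
  "sweep n [] p k = k p"
| "sweep n (u # us) p k = chase n p u (\<lambda>q. sweep n us q k)"

text \<open>The distance to the fixed centre \<open>v\<close> is the potential: amortized, each
  target costs \<open>2 * i\<close> steps and one final query. Later walks only move forward, so
  reachability from earlier targets persists.\<close>

lemma run_sweep:
  assumes "USO n s" "v \<in> cube n" "p \<in> cube n"
    and "\<And>u. u \<in> set us \<Longrightarrow> u \<in> cube n \<and> card (sdiff v u) \<le> i"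
  shows "\<exists>q c. q \<in> cube n \<and> (arc n s)\<^sup>*\<^sup>* p q \<and> (\<forall>u\<in>set us. (arc n s)\<^sup>*\<^sup>* u q) \<and>
           (\<forall>k. run s (sweep n us p k) = add_queries c (run s (k q))) \<and>
           c + card (sdiff v q) \<le> card (sdiff v p) + length us * (2 * i + 1)"
  using assms(3,4)
proof (induction us arbitrary: p)
  case Nil
  then show ?case by (intro exI[of _ p] exI[of _ 0]) simp
next
  case (Cons u us)
  then have u: "u \<in> cube n" "card (sdiff v u) \<le> i" by auto
  from run_chase[OF assms(1) u(1) Cons.prems(1) card_sdiff_le_dim[OF Cons.prems(1) u(1)]]
  obtain q c where q: "q \<in> cube n" "(arc n s)\<^sup>*\<^sup>* p q" "(arc n s)\<^sup>*\<^sup>* u q"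
    "\<And>k. run s (chase n p u k) = add_queries c (run s (k q))"
    "c + card (sdiff q u) \<le> card (sdiff p u) + 1" by blast
  from Cons.IH[OF q(1)] Cons.prems(2)
  obtain q' c' where q': "q' \<in> cube n" "(arc n s)\<^sup>*\<^sup>* q q'" "\<forall>u\<in>set us. (arc n s)\<^sup>*\<^sup>* u q'"
    "\<And>k. run s (sweep n us q k) = add_queries c' (run s (k q'))"
    "c' + card (sdiff v q') \<le> card (sdiff v q) + length us * (2 * i + 1)" by auto
  have fin: "finite p" "finite q" "finite u" "finite v"
    using Cons.prems(1) q(1) u(1) assms(2) by (auto intro: finite_cube_member)
  \<comment> \<open>The detours \<open>p\<close>-\<open>v\<close>-\<open>u\<close> and
    \<open>v\<close>-\<open>u\<close>-\<open>q\<close> each contribute one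
    \<open>card (sdiff v u) \<le> i\<close>.\<close>
  have "card (sdiff p u) \<le> card (sdiff v p) + card (sdiff v u)"
    using card_sdiff_triangle[OF fin(1,4,3)] by (simp add: sdiff_commute)
  moreover have "card (sdiff v q) \<le> card (sdiff v u) + card (sdiff q u)"
    using card_sdiff_triangle[OF fin(4,3,2)] by (simp add: sdiff_commute)
  ultimately have "c + card (sdiff v q) \<le> card (sdiff v p) + (2 * i + 1)"
    using q(5) u(2) by linarith
  then have "c + c' + card (sdiff v q') \<le> card (sdiff v p) + length (u # us) * (2 * i + 1)"
    using q'(5) by simp
  moreover have "run s (sweep n (u # us) p k) = add_queries (c + c') (run s (k q'))" for k
    by (simp add: q(4) q'(4) add_queries_add)
  moreover have "(arc n s)\<^sup>*\<^sup>* p q'" "(arc n s)\<^sup>*\<^sup>* u q'"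
    using rtranclp_trans[OF q(2) q'(2)] rtranclp_trans[OF q(3) q'(2)] by blast+
  ultimately show ?case
    using q'(1,3) by (intro exI[of _ q'] exI[of _ "c + c'"]) simp
qed

section \<open>Candidates for covering vertices\<close>

text \<open>Endpoints of walks of \<open>i\<close> steps, each staying put or flipping a coordinate.
  Repetitions are kept, which makes the length exactly \<open>(n + 1) ^ i\<close>. The list is
  independent of \<open>s\<close>, so building it costs no query.\<close>

primrec ball :: "nat \<Rightarrow> nat \<Rightarrow> nat set \<Rightarrow> nat set list" where
  "ball n 0 v = [v]"
| "ball n (Suc i) v =
     concat (map (\<lambda>u. u # map (\<lambda>j. sdiff u {j}) [0..<n]) (ball n i v))"

lemma ball_Suc_iff:
  "u \<in> set (ball n (Suc i) v) \<longleftrightarrow> (\<exists>w\<in>set (ball n i v). u = w \<or> (\<exists>j<n. u = sdiff w {j}))"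
  by (simp add: image_iff Bex_def atLeast0LessThan) blast

lemma length_ball: "length (ball n i v) = (n + 1) ^ i"
proof (induction i)
  case (Suc i)
  have "(\<lambda>x. length (x # map (\<lambda>j. sdiff x {j}) [0..<n])) = (\<lambda>x. n + 1)" by auto
  then show ?case using Suc by (simp add: length_concat comp_def sum_list_triv)
qed simp

lemma ball_near:
  assumes "v \<in> cube n"
  shows "u \<in> set (ball n i v) \<Longrightarrow> u \<in> cube n \<and> card (sdiff v u) \<le> i"
proof (induction i arbitrary: u)
  case 0
  then show ?case using assms by simp
next
  case (Suc i)
  then obtain w where w: "w \<in> set (ball n i v)"
    and u: "u = w \<or> (\<exists>j<n. u = sdiff w {j})" unfolding ball_Suc_iff by blast
  note IH = Suc.IH[OF w]
  from u show ?case
  proof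
    assume "u = w"
    with IH show ?thesis by simp
  next
    assume "\<exists>j<n. u = sdiff w {j}"
    then obtain j where j: "j < n" "u = sdiff w {j}" by blast
    then have cube: "u \<in> cube n" using IH by (simp add: sdiff_singleton_in_cube)
    have "sdiff w u \<subseteq> {j}" unfolding j(2) by (auto simp: sdiff_def)
    then have "card (sdiff w u) \<le> 1" using card_mono[of "{j}" "sdiff w u"] by simp
    moreover have "card (sdiff v u) \<le> card (sdiff v w) + card (sdiff w u)"
      using assms IH cube by (intro card_sdiff_triangle) (auto intro: finite_cube_member)
    ultimately show ?thesis using IH cube by simp
  qed
qed

text \<open>Arcs are flips, and shorter paths are padded by staying put.\<close>

lemma path_in_ball:
  "(arc n s ^^ k) v u \<Longrightarrow> k \<le> i \<Longrightarrow> u \<in> set (ball n i v)"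
proof (induction i arbitrary: k u)
  case 0
  then have "u = v" by simp
  then show ?case by simp
next
  case (Suc i)
  show ?case
  proof (cases "k \<le> i")
    case True
    with Suc.prems(1) have "u \<in> set (ball n i v)" by (rule Suc.IH)
    then show ?thesis unfolding ball_Suc_iff by blast
  next
    case False
    with Suc.prems(2) have "k = Suc i" by simp
    with Suc.prems(1) have "(arc n s ^^ Suc i) v u" by simp
    then obtain w where w: "(arc n s ^^ i) v w" "arc n s w u"
      by (rule relpowp_Suc_E)
    from w(1) have "w \<in> set (ball n i v)" by (rule Suc.IH) simp
    moreover obtain j where "j < n" "u = sdiff w {j}" using w(2) unfolding arc_def by blast
    ultimately show ?thesis unfolding ball_Suc_iff by blast
  qed
qed

lemma dist_le_in_ball: "dist_le n s v u i \<Longrightarrow> u \<in> set (ball n i v)"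
  unfolding dist_le_def using path_in_ball by blast

section \<open>Shrinking reachmaps and the bound on rounds\<close>

lemma reachmap_mono: "(arc n s)\<^sup>*\<^sup>* u q \<Longrightarrow> reachmap n s q \<subseteq> reachmap n s u"
  unfolding reachmap_def by (blast dest: rtranclp_trans)

lemma reachmap_subset:
  assumes "USO n s" "v \<in> cube n"
  shows "reachmap n s v \<subseteq> {0..<n}"
proof -
  have reach: "(arc n s)\<^sup>*\<^sup>* v u \<Longrightarrow> u \<in> cube n" for u
    by (induction rule: rtranclp_induct)
      (use assms(2) in \<open>auto simp: arc_def sdiff_singleton_in_cube\<close>)
  have "s u \<subseteq> {0..<n}" if "u \<in> cube n" for u
    using assms(1) that by (simp add: USO_def orientation_def)
  then show ?thesis
    using assms(2) reach unfolding reachmap_def by blast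
qed

primrec rounds :: "nat \<Rightarrow> nat \<Rightarrow> nat \<Rightarrow> nat set \<Rightarrow> alg" where
  "rounds n i 0 v = Output v"
| "rounds n i (Suc m) v = sweep n (ball n i v) v (rounds n i m)"

lemma run_rounds:
  assumes "USO n s" "nice n i s" "v \<in> cube n" "card (reachmap n s v) \<le> m"
  shows "global_sink n s (fst (run s (rounds n i m v))) \<and>
         snd (run s (rounds n i m v)) \<le> m * ((n + 1) ^ i * (2 * i + 1))"
  using assms(3,4)
proof (induction m arbitrary: v)
  case 0
  have "finite (reachmap n s v)"
    using reachmap_subset[OF assms(1) 0(1)] by (rule finite_subset) simp
  then have "s v = {}" using 0(2) by (auto simp: reachmap_def)
  then show ?case using 0(1) by (simp add: global_sink_def)
next
  case (Suc m)
  from run_sweep[OF assms(1) Suc.prems(1) Suc.prems(1) ball_near[OF Suc.prems(1), of _ i]]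
  obtain q c where q: "q \<in> cube n" "(arc n s)\<^sup>*\<^sup>* v q" "\<forall>u\<in>set (ball n i v). (arc n s)\<^sup>*\<^sup>* u q"
    "\<And>k. run s (sweep n (ball n i v) v k) = add_queries c (run s (k q))"
    "c + card (sdiff v q) \<le> card (sdiff v v) + length (ball n i v) * (2 * i + 1)"
    by blast
  have fin: "finite (reachmap n s v)"
    using reachmap_subset[OF assms(1) Suc.prems(1)] by (rule finite_subset) simp
  have "card (reachmap n s q) \<le> m"
  proof (cases "global_sink n s v")
    \<comment> \<open>Rounds continue after the sink is found, but no walk can leave it.\<close>
    case True
    then have no_arc: "\<not> arc n s v w" for w by (simp add: global_sink_def arc_def)
    have stuck: "u = v" if "(arc n s)\<^sup>*\<^sup>* v u" for u
      using that by (cases rule: converse_rtranclpE) (simp_all add: no_arc)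
    then have "q = v" using q(2) .
    moreover have "reachmap n s v = {}"
      using True stuck unfolding reachmap_def global_sink_def by blast
    ultimately show ?thesis by simp
  next
    case False
    \<comment> \<open>The algorithm does not know \<open>u\<close>, but \<open>u\<close> is among
      the targets of the round.\<close>
    then obtain u where u: "dist_le n s v u i" "reachmap n s u \<subset> reachmap n s v"
      using assms(2) Suc.prems(1) unfolding nice_def covered_def by blast
    have "(arc n s)\<^sup>*\<^sup>* u q" using q(3) dist_le_in_ball[OF u(1)] by blast
    then have "reachmap n s q \<subset> reachmap n s v"
      by (rule subset_psubset_trans[OF reachmap_mono u(2)])
    with fin have "card (reachmap n s q) < card (reachmap n s v)" by (rule psubset_card_mono)
    with Suc.prems(2) show ?thesis by simp
  qed
  from Suc.IH[OF q(1) this] show ?case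
    using q(5) by (simp add: q(4) add_queries_def length_ball)
qed

theorem theorem6:
  shows "\<forall>i::nat. \<exists>C::nat. \<forall>n::nat. \<exists>A::alg.
           \<forall>s. USO n s \<and> nice n i s \<longrightarrow>
             global_sink n s (fst (run s A)) \<and> snd (run s A) \<le> C * n ^ (i + 1)"
proof (intro allI)
  fix i :: nat
  \<comment> \<open>The constant comes from \<open>n + 1 \<le> 2 * n\<close> for positive
    \<open>n\<close>; at \<open>n = 0\<close> both sides vanish.\<close>
  have bound: "n * ((n + 1) ^ i * (2 * i + 1)) \<le> (2 ^ i * (2 * i + 1)) * n ^ (i + 1)" for n :: nat
  proof (cases "n = 0")
    case False
    then have "(n + 1) ^ i \<le> (2 * n) ^ i" by (intro power_mono) auto
    then have "n * ((n + 1) ^ i * (2 * i + 1)) \<le> n * ((2 * n) ^ i * (2 * i + 1))"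
      by (intro mult_le_mono le_refl)
    then show ?thesis by (simp add: power_mult_distrib mult_ac)
  qed simp
  have "global_sink n s (fst (run s (rounds n i n {}))) \<and>
        snd (run s (rounds n i n {})) \<le> (2 ^ i * (2 * i + 1)) * n ^ (i + 1)"
    if "USO n s" "nice n i s" for n s
  proof -
    \<comment> \<open>A reachmap has at most \<open>n\<close> coordinates and each round removes one
      until the sink is found, hence \<open>n\<close> rounds.\<close>
    have start: "{} \<in> cube n" by (simp add: cube_def)
    then have "card (reachmap n s {}) \<le> n"
      using card_mono[OF _ reachmap_subset[OF that(1) start]] by simp
    from run_rounds[OF that start this] bound[of n] show ?thesis
      using le_trans by blast
  qed
  then show "\<exists>C::nat. \<forall>n::nat. \<exists>A::alg. \<forall>s. USO n s \<and> nice n i s \<longrightarrow>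
      global_sink n s (fst (run s A)) \<and> snd (run s A) \<le> C * n ^ (i + 1)"
    by blast
qed

end
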